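(* Let $\mathcal P_n$ be the poset whose elements are the lattice path matroids on $[n]$, ordered by the quotient relation $\leq_Q$. Then $\mathcal P_n$ is graded, with minimum $U_{0,n}$ and maximum $U_{n,n}$.
   Context: $[n]=\{1,\dots,n\}$. For $A,B\in\binom{[n]}{k}$ with $A=\{a_1<\dots<a_k\}$, $B=\{b_1<\dots<b_k\}$, $A\leq_G B$ (Gale order) iff $a_i\leq b_i$ for all $i$. For $0\leq k\leq n$ and $U\leq_G L$ in $\binom{[n]}{k}$, the lattice path matroid (LPM) $M[U,L]$ is the matroid of rank $k$ on $[n]$ with set of bases $\{B\in\binom{[n]}{k}: U\leq_G B\leq_G L\}$. $U_{k,n}$ denotes the uniform matroid of rank $k$ on $[n]$ (all $k$-subsets are bases); it is an LPM. For matroids $M,M'$ on $[n]$ with sets of bases $\mathcal B,\mathcal B'$, $M'$ is a quotient of $M$, written $M'\leq_Q M$, if for all $B\in\mathcal B$ and $p\in[n]\setminus B$ there is $B'\in\mathcal B'$ with $B'\subseteq B$ such that for all $q\in B'$: if $(B'\cup\{p\})\setminus\{q\}\in\mathcal B'$ then $(B\cup\{p\})\setminus\{q\}\in\mathcal B$. *)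

theory Defs
  imports Main
begin

text \<open>
  All matroids considered here have ground set \<open>{1..n}\<close>, so a matroid is represented by
  its set of bases.
\<close>

definition matroid_bases :: "'a set \<Rightarrow> 'a set set \<Rightarrow> bool" where
  "matroid_bases E \<B> \<longleftrightarrow>
     finite E \<and> \<B> \<subseteq> Pow E \<and> \<B> \<noteq> {} \<and>
     (\<forall>A\<in>\<B>. \<forall>B\<in>\<B>. \<forall>a\<in>A - B. \<exists>b\<in>B - A. (A \<union> {b}) - {a} \<in> \<B>)"

definition k_subsets :: "nat \<Rightarrow> nat \<Rightarrow> nat set set" where
  "k_subsets n k = {B. B \<subseteq> {1..n} \<and> card B = k}"

definition gale_le :: "nat set \<Rightarrow> nat set \<Rightarrow> bool"  (infix \<open>\<le>\<^sub>G\<close> 50) where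
  "A \<le>\<^sub>G B \<longleftrightarrow> card A = card B \<and>
     (\<forall>i<card A. sorted_list_of_set A ! i \<le> sorted_list_of_set B ! i)"

definition lpm :: "nat \<Rightarrow> nat \<Rightarrow> nat set \<Rightarrow> nat set \<Rightarrow> nat set set" where
  "lpm n k U L = {B \<in> k_subsets n k. U \<le>\<^sub>G B \<and> B \<le>\<^sub>G L}"

definition lattice_path_matroids :: "nat \<Rightarrow> nat set set set" where
  "lattice_path_matroids n =
     {lpm n k U L | k U L. k \<le> n \<and> U \<in> k_subsets n k \<and> L \<in> k_subsets n k \<and> U \<le>\<^sub>G L}"

definition uniform_matroid :: "nat \<Rightarrow> nat \<Rightarrow> nat set set" where
  "uniform_matroid k n = k_subsets n k"

text \<open>\<open>matroid_quotient E \<B>' \<B>\<close>: the matroid with bases \<open>\<B>'\<close> is a quotient of the one with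
  bases \<open>\<B>\<close>, both having ground set \<open>E\<close>.\<close>

definition matroid_quotient :: "'a set \<Rightarrow> 'a set set \<Rightarrow> 'a set set \<Rightarrow> bool" where
  "matroid_quotient E \<B>' \<B> \<longleftrightarrow>
     (\<forall>B\<in>\<B>. \<forall>p\<in>E - B. \<exists>B'\<in>\<B>'. B' \<subseteq> B \<and>
        (\<forall>q\<in>B'. (B' \<union> {p}) - {q} \<in> \<B>' \<longrightarrow> (B \<union> {p}) - {q} \<in> \<B>))"

definition lpm_quotient_order :: "nat \<Rightarrow> (nat set set \<times> nat set set) set" where
  "lpm_quotient_order n =
     {(M', M). M' \<in> lattice_path_matroids n \<and> M \<in> lattice_path_matroids n \<and>
               matroid_quotient {1..n} M' M}"

text \<open>A poset is graded if all its maximal chains are finite of the same length; a chain with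
  \<open>m + 1\<close> elements has length \<open>m\<close>.\<close>

definition graded_poset :: "'a set \<Rightarrow> ('a \<times> 'a) set \<Rightarrow> bool" where
  "graded_poset P r \<longleftrightarrow>
     partial_order_on P r \<and>
     (\<exists>m::nat. \<forall>C. pred_on.maxchain P (\<lambda>x y. (x, y) \<in> r) C \<longrightarrow> finite C \<and> card C = m + 1)"

text \<open>The sets \<open>lpm n k U L\<close> are indeed sets of bases of matroids.\<close>

lemma sorted_list_of_set_nth_le_iff:
  fixes A :: "nat set"
  assumes "finite A" "i < card A"
  shows "sorted_list_of_set A ! i \<le> m \<longleftrightarrow> i < card (A \<inter> {..m})"
proof -
  define xs where "xs = sorted_list_of_set A"
  have len: "length xs = card A" and set: "set xs = A"
    and sor: "sorted_wrt (<) xs" and dis: "distinct xs"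
    using assms by (auto simp: xs_def)
  have mono: "xs ! j \<le> xs ! l" if "j \<le> l" "l < card A" for j l
    using sorted_wrt_nth_less[OF sor, of j l] that len by (cases "j = l") auto
  have card_im: "card ((!) xs ` J) = card J" if "J \<subseteq> {..<card A}" for J
    using that dis len by (intro card_image inj_on_subset[OF inj_on_nth]) auto
  show ?thesis
  proof (cases "xs ! i \<le> m")
    case True
    have "(!) xs ` {..i} \<subseteq> A \<inter> {..m}"
    proof
      fix x assume "x \<in> (!) xs ` {..i}"
      then obtain j where "j \<le> i" "x = xs ! j" by auto
      then show "x \<in> A \<inter> {..m}"
        using mono[of j i] True assms(2) len set nth_mem[of j xs] by auto
    qed
    then have "card ((!) xs ` {..i}) \<le> card (A \<inter> {..m})"
      using assms(1) by (intro card_mono) auto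
    moreover have "card ((!) xs ` {..i}) = Suc i"
      using card_im[of "{..i}"] assms(2) by (simp add: subset_eq)
    ultimately show ?thesis using True xs_def by simp
  next
    case False
    have "A \<inter> {..m} \<subseteq> (!) xs ` {..<i}"
    proof
      fix x assume x: "x \<in> A \<inter> {..m}"
      then obtain j where j: "j < card A" "x = xs ! j"
        using set len by (metis IntD1 in_set_conv_nth)
      then have "j < i"
        using mono[of i j] False x by (metis IntD2 atMost_iff le_trans not_le)
      with j show "x \<in> (!) xs ` {..<i}" by auto
    qed
    then have "card (A \<inter> {..m}) \<le> i"
      by (metis card_image_le card_lessThan card_mono finite_imageI finite_lessThan le_trans)
    then show ?thesis using False xs_def by simp
  qed
qed

lemma gale_le_iff_card:
  assumes "finite A" "finite B" "card A = card B"
  shows "A \<le>\<^sub>G B \<longleftrightarrow> (\<forall>m. card (B \<inter> {..m}) \<le> card (A \<inter> {..m}))"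
proof
  assume g: "A \<le>\<^sub>G B"
  show "\<forall>m. card (B \<inter> {..m}) \<le> card (A \<inter> {..m})"
  proof (rule allI, rule ccontr)
    fix m
    assume "\<not> card (B \<inter> {..m}) \<le> card (A \<inter> {..m})"
    then have lt: "card (A \<inter> {..m}) < card (B \<inter> {..m})" by simp
    moreover have "card (B \<inter> {..m}) \<le> card B" using assms(2) by (intro card_mono) auto
    ultimately have i: "card (A \<inter> {..m}) < card B" by simp
    then have "sorted_list_of_set B ! card (A \<inter> {..m}) \<le> m"
      using lt sorted_list_of_set_nth_le_iff[OF assms(2) i] by simp
    then have "sorted_list_of_set A ! card (A \<inter> {..m}) \<le> m"
      using g i assms(3) unfolding gale_le_def by (metis le_trans)
    then show False
      using sorted_list_of_set_nth_le_iff[OF assms(1)] i assms(3) by (metis less_irrefl)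
  qed
next
  assume c: "\<forall>m. card (B \<inter> {..m}) \<le> card (A \<inter> {..m})"
  show "A \<le>\<^sub>G B"
    unfolding gale_le_def
  proof (intro conjI allI impI)
    fix i assume i: "i < card A"
    have "i < card (B \<inter> {..sorted_list_of_set B ! i})"
      using sorted_list_of_set_nth_le_iff[OF assms(2)] i assms(3) by (metis order_refl)
    then show "sorted_list_of_set A ! i \<le> sorted_list_of_set B ! i"
      using sorted_list_of_set_nth_le_iff[OF assms(1) i] c less_le_trans by blast
  qed (rule assms(3))
qed

lemma card_exchange_atMost:
  fixes A :: "nat set"
  assumes "finite A" "a \<in> A" "b \<notin> A"
  shows "card (((A \<union> {b}) - {a}) \<inter> {..m}) + (if a \<le> m then 1 else 0) =
         card (A \<inter> {..m}) + (if b \<le> m then 1 else 0)"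
proof -
  have "card ((A \<union> {b}) \<inter> {..m}) = card (A \<inter> {..m}) + (if b \<le> m then 1 else 0)"
  proof (cases "b \<le> m")
    case True
    then have "(A \<union> {b}) \<inter> {..m} = insert b (A \<inter> {..m})" by auto
    then show ?thesis using True assms by simp
  next
    case False
    then have "(A \<union> {b}) \<inter> {..m} = A \<inter> {..m}" by auto
    then show ?thesis using False by simp
  qed
  moreover have "card (((A \<union> {b}) - {a}) \<inter> {..m}) + (if a \<le> m then 1 else 0) =
      card ((A \<union> {b}) \<inter> {..m})"
  proof (cases "a \<le> m")
    case True
    then have "(A \<union> {b}) \<inter> {..m} = insert a (((A \<union> {b}) - {a}) \<inter> {..m})"
      using assms by auto
    moreover have "card (insert a (((A \<union> {b}) - {a}) \<inter> {..m})) =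
        Suc (card (((A \<union> {b}) - {a}) \<inter> {..m}))"
      using assms by (intro card_insert_disjoint) auto
    ultimately show ?thesis using True by simp
  next
    case False
    then have "((A \<union> {b}) - {a}) \<inter> {..m} = (A \<union> {b}) \<inter> {..m}" by auto
    then show ?thesis using False by simp
  qed
  ultimately show ?thesis by simp
qed

lemma card_Int_atMost_Suc:
  fixes A :: "nat set"
  assumes "finite A"
  shows "card (A \<inter> {..Suc m}) = card (A \<inter> {..m}) + (if Suc m \<in> A then 1 else 0)"
proof (cases "Suc m \<in> A")
  case True
  then have "A \<inter> {..Suc m} = insert (Suc m) (A \<inter> {..m})" by (auto simp: le_Suc_eq)
  then show ?thesis using True assms by simp
next
  case False
  then have "A \<inter> {..Suc m} = A \<inter> {..m}" by (auto simp: le_Suc_eq)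
  then show ?thesis using False by simp
qed

lemma lpm_matroid_bases:
  assumes U: "U \<in> k_subsets n k" and L: "L \<in> k_subsets n k" and UL: "U \<le>\<^sub>G L"
  shows "matroid_bases {1..n} (lpm n k U L)"
proof -
  define c where "c = (\<lambda>A m. card (A \<inter> {..m::nat}))"
  have fin: "finite A" and crd: "card A = k" and sub: "A \<subseteq> {1..n}" if "A \<in> k_subsets n k" for A
    using that finite_subset by (auto simp: k_subsets_def)
  have gale: "A \<le>\<^sub>G B \<longleftrightarrow> (\<forall>m. c B m \<le> c A m)" if "A \<in> k_subsets n k" "B \<in> k_subsets n k" for A B
    unfolding c_def using gale_le_iff_card[of A B] fin crd that by simp
  have mem: "A \<in> lpm n k U L \<longleftrightarrow> A \<in> k_subsets n k \<and> (\<forall>m. c L m \<le> c A m \<and> c A m \<le> c U m)" for A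
    unfolding lpm_def using gale[OF U, of A] gale[OF _ L, of A] by blast
  have c0: "c A 0 = 0" and cn: "c A n = k" if "A \<in> k_subsets n k" for A
  proof -
    have "A \<inter> {..0} = {}" "A \<inter> {..n} = A" using sub[OF that] by auto
    then show "c A 0 = 0" "c A n = k" using crd[OF that] by (auto simp: c_def)
  qed
  have cS: "c A (Suc m) = c A m + (if Suc m \<in> A then 1 else 0)" if "A \<in> k_subsets n k" for A m
    unfolding c_def using card_Int_atMost_Suc[OF fin[OF that]] .
  have exch: "\<exists>b\<in>B - A. (A \<union> {b}) - {a} \<in> lpm n k U L"
    if AB: "A \<in> lpm n k U L" "B \<in> lpm n k U L" and a: "a \<in> A - B" for A B a
  proof -
    have A: "A \<in> k_subsets n k" and B: "B \<in> k_subsets n k" using AB mem by auto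
    have a1: "1 \<le> a" "a \<le> n" using a sub[OF A] by auto
    have cex: "c ((A \<union> {b}) - {a}) m + (if a \<le> m then 1 else 0) = c A m + (if b \<le> m then 1 else 0)"
      if "b \<in> B - A" for b m
      unfolding c_def using card_exchange_atMost[OF fin[OF A]] that a by simp
    have kex: "(A \<union> {b}) - {a} \<in> k_subsets n k" if "b \<in> B - A" for b
    proof -
      have s: "(A \<union> {b}) - {a} \<subseteq> {1..n}" using sub[OF A] sub[OF B] that by auto
      then have "((A \<union> {b}) - {a}) \<inter> {..n} = (A \<union> {b}) - {a}" by auto
      moreover have "b \<le> n" using that sub[OF B] by auto
      ultimately have "card ((A \<union> {b}) - {a}) = k"
        using cex[OF that, of n] a1 cn[OF A] by (simp add: c_def)
      with s show ?thesis by (simp add: k_subsets_def)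
    qed
    obtain a' where a': "a = Suc a'" using a1 by (cases a) auto
    show ?thesis
    proof (cases "c B a < c A a")
      case True
      have ex: "a < n \<and> c A n \<le> c B n"
        using True a1 cn[OF A] cn[OF B] by (metis le_neq_implies_less less_irrefl order_refl)
      define b where "b = (LEAST m. a < m \<and> c A m \<le> c B m)"
      have b: "a < b" "c A b \<le> c B b"
        using LeastI[of "\<lambda>m. a < m \<and> c A m \<le> c B m", OF ex] by (auto simp: b_def)
      have between: "c B m < c A m" if "a \<le> m" "m < b" for m
        using that not_less_Least[of m "\<lambda>m. a < m \<and> c A m \<le> c B m"] True
        by (cases "m = a") (auto simp: b_def)
      obtain b' where b': "b = Suc b'" using b(1) by (cases b) auto
      have "c B b' < c A b'" using between b b' by simp
      then have bm: "b \<in> B - A"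
        using b(2) cS[OF A, of b'] cS[OF B, of b'] b' by (auto split: if_splits)
      have "c L m \<le> c ((A \<union> {b}) - {a}) m \<and> c ((A \<union> {b}) - {a}) m \<le> c U m" for m
      proof -
        have "c L m \<le> c A m" "c A m \<le> c U m" "c L m \<le> c B m" using AB mem by auto
        then show ?thesis using cex[OF bm, of m] between[of m] b(1) by (auto split: if_splits)
      qed
      then show ?thesis using bm kex mem by blast
    next
      case False
      have da: "c A a' < c B a'"
        using False a cS[OF A, of a'] cS[OF B, of a'] a' by auto
      define P where "P = (\<lambda>m. m \<le> a' \<and> c B m \<le> c A m)"
      define b' where "b' = (GREATEST m. P m)"
      have P0: "P 0" using c0 A B by (simp add: P_def)
      have bd: "\<And>m. P m \<Longrightarrow> m \<le> a'" by (simp add: P_def)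
      have b': "P b'" unfolding b'_def using GreatestI_nat[of P, OF P0 bd] .
      have gr: "m \<le> b'" if "P m" for m
        unfolding b'_def using Greatest_le_nat[of P, OF that bd] .
      have lt: "b' < a'" using b' da unfolding P_def by (metis le_neq_implies_less not_le)
      have between: "c A m < c B m" if "b' < m" "m < a" for m
        using gr[of m] that a' unfolding P_def by fastforce
      have bm: "Suc b' \<in> B - A"
        using between[of "Suc b'"] lt b' a' cS[OF A, of b'] cS[OF B, of b']
        unfolding P_def by (auto split: if_splits)
      have "c L m \<le> c ((A \<union> {Suc b'}) - {a}) m \<and> c ((A \<union> {Suc b'}) - {a}) m \<le> c U m" for m
      proof -
        have "c L m \<le> c A m" "c A m \<le> c U m" "c B m \<le> c U m" using AB mem by auto
        then show ?thesis using cex[OF bm, of m] between[of m] lt a' by (auto split: if_splits)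
      qed
      then show ?thesis using bm kex mem by blast
    qed
  qed
  have "U \<in> lpm n k U L" using U L UL by (simp add: lpm_def gale_le_def)
  moreover have "lpm n k U L \<subseteq> Pow {1..n}" by (auto simp: lpm_def k_subsets_def)
  ultimately show ?thesis unfolding matroid_bases_def using exch by blast
qed

corollary lattice_path_matroids_matroid_bases:
  "M \<in> lattice_path_matroids n \<Longrightarrow> matroid_bases {1..n} M"
  unfolding lattice_path_matroids_def using lpm_matroid_bases by blast

end

theory Submission
  imports Defs
begin

text \<open>
  Read a set \<open>A \<subseteq> {1..n}\<close> as the lattice path whose \<open>m\<close>-th step goes north if \<open>m \<in> A\<close> and
  east otherwise; \<open>height A m\<close> is its height after \<open>m\<close> steps. The bases of \<open>lpm n k U L\<close> are
  then the paths that run between \<open>L\<close> below and \<open>U\<close> above.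

  The proof rests on a description of the quotient relation in terms of the boundary paths.
  If \<open>M[U',L']\<close> is a quotient of \<open>M[U,L]\<close>, then \<open>U' \<subseteq> U\<close> and \<open>L' \<subseteq> L\<close>, so that \<open>U'\<close> and \<open>L'\<close>
  arise by deleting equally many north steps from \<open>U\<close> and from \<open>L\<close>. Pair the deleted steps
  in increasing order. The claim is that \<open>M[U',L']\<close> is a quotient exactly if every pair
  \<open>(d, e)\<close>, with \<open>d\<close> a step of \<open>U\<close> and \<open>e\<close> a step of \<open>L\<close>, satisfies two inequalities: \<open>e\<close> is
  at most as high as \<open>d\<close>, and \<open>d\<close> is at most as far east as \<open>e\<close>. This is the predicate
  \<open>paired_removal\<close>.

  Necessity (\<open>quotient_imp_paired_removal\<close>): each violated inequality yields a basis of
  \<open>M[U,L]\<close> that refutes the quotient property. A pair with \<open>e\<close> too high leaves a stretch in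
  which some basis of \<open>M[U,L]\<close> has fewer elements than every basis of \<open>M[U',L']\<close>; a pair with
  \<open>d\<close> too far east gives an interval that is a circuit of \<open>M[U,L]\<close> and whose last element is
  not spanned by the others in \<open>M[U',L']\<close>.

  Sufficiency (\<open>paired_removal_imp_quotient\<close>): fundamental circuits of a lattice path matroid
  are windows between two points where the path of the basis touches the boundary
  (\<open>exchange_window\<close>), so deleting a single good pair gives a quotient as soon as a north step
  can be deleted from the basis at a place that preserves these two touching points
  (\<open>remove_pair_quotient\<close>). The general case follows by induction, since deleting the first
  pair moves every later pair down and east by one unit on both sides and so preserves its two
  inequalities (\<open>paired_removal_first_pair\<close>), and quotients compose.

  The same induction step shows that a quotient of corank at least two has a lattice path
  matroid strictly between its two ends, while a quotient of corank zero is an equality.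
  Hence the matroid rank is strictly monotone and has no gaps, the rank-0 and rank-\<open>n\<close> uniform
  matroids lie below and above everything, and every maximal chain meets each rank
  \<open>0, \<dots>, n\<close> exactly once (\<open>graded_posetI\<close>).
\<close>

section \<open>Lattice paths and their heights\<close>

definition height :: "nat set \<Rightarrow> nat \<Rightarrow> nat" where
  "height A m = card (A \<inter> {..m})"

lemma height_0: "A \<subseteq> {1..n} \<Longrightarrow> height A 0 = 0"
  by (auto simp: height_def)

lemma height_Suc:
  "finite A \<Longrightarrow> height A (Suc m) = height A m + (if Suc m \<in> A then 1 else 0)"
  unfolding height_def by (rule card_Int_atMost_Suc)

lemma height_top: "A \<subseteq> {1..n} \<Longrightarrow> n \<le> m \<Longrightarrow> height A m = card A"
  unfolding height_def by (rule arg_cong[of _ _ card]) auto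

lemma height_mono: "finite A \<Longrightarrow> a \<le> b \<Longrightarrow> height A a \<le> height A b"
  unfolding height_def by (intro card_mono) auto

lemma height_slope: "finite A \<Longrightarrow> a \<le> b \<Longrightarrow> height A b \<le> height A a + (b - a)"
proof (induction b)
  case (Suc b)
  then show ?case by (cases "a = Suc b") (auto simp: height_Suc)
qed simp

lemma height_less: "finite A \<Longrightarrow> e \<in> A \<Longrightarrow> m < e \<Longrightarrow> height A m < height A e"
  using height_mono[of A m "e - 1"] height_Suc[of A "e - 1"] by (cases e) auto

lemma height_subset: "finite A \<Longrightarrow> B \<subseteq> A \<Longrightarrow> height A m = height B m + height (A - B) m"
  unfolding height_def
  by (subst card_Un_disjoint[symmetric]) (auto intro: finite_subset arg_cong[of _ _ card])

lemma height_remove: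
  assumes "finite A" "d \<in> A"
  shows "height A m = height (A - {d}) m + (if d \<le> m then 1 else 0)"
  using assms height_subset[of A "{d}" m] by (auto simp: height_def)

lemma height_constant:
  assumes "finite A" "a \<le> b" "\<And>q. q \<in> A \<Longrightarrow> a < q \<Longrightarrow> q \<le> b \<Longrightarrow> False"
  shows "height A b = height A a"
  unfolding height_def
proof (rule arg_cong[of _ _ card])
  show "A \<inter> {..b} = A \<inter> {..a}"
    using assms(2,3) by (auto simp: not_le[symmetric] intro: order_trans)
qed

lemma height_less_imp_elem:
  assumes "finite A" "height A a < height A b"
  obtains q where "q \<in> A" "a < q" "q \<le> b"
proof -
  have "a \<le> b" using assms height_mono[of A b a] by linarith
  then show ?thesis using assms height_constant[of A a b] that by fastforce
qed

lemma height_exchange: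
  assumes "finite A" "q \<in> A" "p \<notin> A"
  shows "height ((A \<union> {p}) - {q}) m + (if q \<le> m then 1 else 0) =
         height A m + (if p \<le> m then 1 else 0)"
  unfolding height_def by (rule card_exchange_atMost[OF assms])

text \<open>
  Bases with prescribed behaviour are constructed by writing down their height functions.
\<close>
lemma path_with_heights:
  fixes f :: "nat \<Rightarrow> nat"
  assumes "f 0 = 0" "\<And>m. m < n \<Longrightarrow> f m \<le> f (Suc m) \<and> f (Suc m) \<le> Suc (f m)"
  obtains A where "A \<subseteq> {1..n}" "\<And>m. m \<le> n \<Longrightarrow> height A m = f m"
proof
  let ?A = "{m \<in> {1..n}. f (m - 1) < f m}"
  show "?A \<subseteq> {1..n}" by auto
  show "height ?A m = f m" if "m \<le> n" for m
    using that
  proof (induction m)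
    case 0
    then show ?case using assms(1) by (auto simp: height_def)
  next
    case (Suc m)
    then show ?case using assms(2)[of m] by (auto simp: height_Suc)
  qed
qed

section \<open>Bases as paths between two boundary paths\<close>
definition path_pair :: "nat \<Rightarrow> nat \<Rightarrow> nat set \<Rightarrow> nat set \<Rightarrow> bool" where
  "path_pair n k U L \<longleftrightarrow> U \<in> k_subsets n k \<and> L \<in> k_subsets n k \<and> U \<le>\<^sub>G L"

lemma k_subsetsD:
  assumes "A \<in> k_subsets n k"
  shows "A \<subseteq> {1..n}" "finite A" "card A = k"
  using assms finite_subset by (auto simp: k_subsets_def)

lemma gale_le_iff_height:
  assumes "A \<in> k_subsets n k" "B \<in> k_subsets n k"
  shows "A \<le>\<^sub>G B \<longleftrightarrow> (\<forall>m\<le>n. height B m \<le> height A m)"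
proof -
  have "height B m \<le> height A m" if "n \<le> m" for m
    using that assms height_top[of _ n m] k_subsetsD by (metis order_refl)
  then show ?thesis
    using gale_le_iff_card[of A B] assms unfolding height_def
    by (metis k_subsetsD(2,3) nle_le)
qed

lemma path_pair_iff:
  "path_pair n k U L \<longleftrightarrow>
     U \<in> k_subsets n k \<and> L \<in> k_subsets n k \<and> (\<forall>m\<le>n. height L m \<le> height U m)"
  unfolding path_pair_def using gale_le_iff_height by blast

lemma path_pairD:
  assumes "path_pair n k U L"
  shows "finite U" "finite L" "U \<subseteq> {1..n}" "L \<subseteq> {1..n}" "card U = k" "card L = k"
    and "\<And>m. m \<le> n \<Longrightarrow> height L m \<le> height U m"
  using assms k_subsetsD unfolding path_pair_iff by blast+

lemma mem_lpm_iff: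
  assumes "path_pair n k U L"
  shows "B \<in> lpm n k U L \<longleftrightarrow>
    B \<subseteq> {1..n} \<and> (\<forall>m\<le>n. height L m \<le> height B m \<and> height B m \<le> height U m)"
proof -
  note UL = path_pairD[OF assms]
  have "card B = k" if "B \<subseteq> {1..n}" "height L n \<le> height B n" "height B n \<le> height U n"
    using that UL height_top[of _ n n] by simp
  then show ?thesis
    using assms gale_le_iff_height[of U n k B] gale_le_iff_height[of B n k L]
    unfolding lpm_def path_pair_def by (auto simp: k_subsets_def)
qed

lemma path_in_lpm:
  assumes UL: "path_pair n k U L"
    and bounds: "\<And>m. m \<le> n \<Longrightarrow> height L m \<le> f m \<and> f m \<le> height U m"
    and steps: "\<And>m. m < n \<Longrightarrow> f m \<le> f (Suc m) \<and> f (Suc m) \<le> Suc (f m)"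
  obtains B where "B \<in> lpm n k U L" "\<And>m. m \<le> n \<Longrightarrow> height B m = f m"
proof -
  have "f 0 = 0" using bounds[of 0] height_0 path_pairD(3)[OF UL] by force
  from path_with_heights[of f, OF this steps] obtain B
    where "B \<subseteq> {1..n}" "\<And>m. m \<le> n \<Longrightarrow> height B m = f m" by blast
  with bounds that show ?thesis by (simp add: mem_lpm_iff[OF UL])
qed

lemma lattice_path_matroidsE:
  assumes "M \<in> lattice_path_matroids n"
  obtains k U L where "path_pair n k U L" "M = lpm n k U L"
  using assms unfolding lattice_path_matroids_def path_pair_def by blast

lemma lpm_in_lattice_path_matroids:
  assumes "path_pair n k U L"
  shows "lpm n k U L \<in> lattice_path_matroids n"
proof -
  have "k \<le> n" using path_pairD[OF assms] card_mono[of "{1..n}" U] by simp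
  then show ?thesis using assms unfolding lattice_path_matroids_def path_pair_def by blast
qed

section \<open>Fundamental circuits are windows\<close>

text \<open>
  Exchanging \<open>p\<close> for an earlier \<open>q\<close> lowers the path by one on the stretch from \<open>q\<close> up to
  \<open>p - 1\<close>, and exchanging it for a later one raises the path by one on the stretch from \<open>p\<close> up
  to \<open>q - 1\<close>. Where the path touches the boundary, no such move is possible, so touching points
  confine the fundamental circuit of \<open>p\<close>.
\<close>
lemma exchange_above_touch:
  assumes UL: "path_pair n k U L" and B: "B \<in> lpm n k U L" and "p \<notin> B" "q \<in> B"
    and ex: "(B \<union> {p}) - {q} \<in> lpm n k U L"
    and a: "a < p" "a \<le> n" "height B a \<le> height L a"
  shows "a < q"
proof (rule ccontr)
  assume "\<not> a < q"
  moreover have "finite B" using B finite_subset unfolding mem_lpm_iff[OF UL] by blast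
  ultimately show False
    using height_exchange[of B q p a] assms ex[unfolded mem_lpm_iff[OF UL]] by force
qed

lemma exchange_below_touch:
  assumes UL: "path_pair n k U L" and B: "B \<in> lpm n k U L" and "p \<notin> B" "q \<in> B"
    and ex: "(B \<union> {p}) - {q} \<in> lpm n k U L"
    and b: "p \<le> b" "b \<le> n" "height U b \<le> height B b"
  shows "q \<le> b"
proof (rule ccontr)
  assume "\<not> q \<le> b"
  moreover have "finite B" using B finite_subset unfolding mem_lpm_iff[OF UL] by blast
  ultimately show False
    using height_exchange[of B q p b] assms ex[unfolded mem_lpm_iff[OF UL]] by force
qed

text \<open>
  Conversely, nothing but the touching points obstructs an exchange. The window reaches from the
  last touch of \<open>L\<close> before \<open>p\<close> to the first touch of \<open>U\<close> at or after \<open>p\<close>; both exist because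
  all paths share their end points.
\<close>
lemma exchange_window:
  assumes UL: "path_pair n k U L" and B: "B \<in> lpm n k U L" and p: "p \<in> {1..n} - B"
  obtains a b where "a < p" "p \<le> b" "b \<le> n" "height B a = height L a" "height B b = height U b"
    and "\<forall>q\<in>B. a < q \<and> q \<le> b \<longrightarrow> (B \<union> {p}) - {q} \<in> lpm n k U L"
proof -
  note UL' = path_pairD[OF UL]
  have sub: "B \<subseteq> {1..n}"
    and lo: "\<And>m. m \<le> n \<Longrightarrow> height L m \<le> height B m"
    and hi: "\<And>m. m \<le> n \<Longrightarrow> height B m \<le> height U m"
    using B unfolding mem_lpm_iff[OF UL] by auto
  have fin: "finite B" using sub finite_subset by blast
  define P where "P m \<longleftrightarrow> m < p \<and> height B m = height L m" for m
  define a where "a = (GREATEST m. P m)"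
  have P0: "P 0" using p sub UL'(4) by (auto simp: P_def height_0)
  have bd: "\<And>m. P m \<Longrightarrow> m \<le> p" by (simp add: P_def)
  have Pa: "P a" unfolding a_def by (rule GreatestI_nat[of P, OF P0 bd])
  have above_a: "height L m < height B m" if "a < m" "m < p" for m
  proof -
    have "\<not> P m" using that Greatest_le_nat[of P m, OF _ bd] unfolding a_def by fastforce
    then show ?thesis using that lo[of m] p by (auto simp: P_def)
  qed
  define Q where "Q m \<longleftrightarrow> p \<le> m \<and> height B m = height U m" for m
  define b where "b = (LEAST m. Q m)"
  have "card B = k" using B by (simp add: lpm_def k_subsets_def)
  then have Qn: "Q n" using p sub UL' by (auto simp: Q_def height_top[of _ n])
  have Qb: "Q b" and bn: "b \<le> n" unfolding b_def using LeastI[of Q, OF Qn] Least_le[of Q, OF Qn] .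
  have below_b: "height B m < height U m" if "p \<le> m" "m < b" for m
    using that hi[of m] not_less_Least[of m Q] bn by (auto simp: Q_def b_def)
  show ?thesis
  proof
    show "a < p" "height B a = height L a" "p \<le> b" "height B b = height U b" "b \<le> n"
      using Pa Qb bn by (auto simp: P_def Q_def)
  next
    show "\<forall>q\<in>B. a < q \<and> q \<le> b \<longrightarrow> (B \<union> {p}) - {q} \<in> lpm n k U L"
    proof (intro ballI impI)
      fix q assume "q \<in> B" "a < q \<and> q \<le> b"
      then have q: "q \<in> B" "a < q" "q \<le> b" by auto
      have "height L m \<le> height ((B \<union> {p}) - {q}) m \<and> height ((B \<union> {p}) - {q}) m \<le> height U m"
        if "m \<le> n" for m
        using height_exchange[OF fin q(1), of p m] p q above_a[of m] below_b[of m]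
          lo[OF that] hi[OF that] by (auto split: if_splits)
      then show "(B \<union> {p}) - {q} \<in> lpm n k U L"
        using p sub unfolding mem_lpm_iff[OF UL] by auto
    qed
  qed
qed

section \<open>Necessary conditions for a quotient\<close>

text \<open>
  The definition of a quotient provides a contained basis only along with an element outside
  \<open>B\<close>, so the full ground set has to be treated separately.
\<close>
lemma quotient_basis_subset:
  assumes "matroid_quotient {1..n} (lpm n k' U' L') (lpm n k U L)"
    and UL': "path_pair n k' U' L'" and UL: "path_pair n k U L" and B: "B \<in> lpm n k U L"
  obtains B' where "B' \<in> lpm n k' U' L'" "B' \<subseteq> B"
proof (cases "B = {1..n}")
  case True
  have "U' \<in> lpm n k' U' L'" using path_pairD[OF UL'] by (simp add: mem_lpm_iff[OF UL'])
  then show ?thesis using that True path_pairD(3)[OF UL'] by blast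
next
  case False
  then obtain p where "p \<in> {1..n} - B" using B unfolding mem_lpm_iff[OF UL] by blast
  then show ?thesis using assms(1) B that unfolding matroid_quotient_def by blast
qed

lemma quotient_window:
  assumes quot: "matroid_quotient {1..n} (lpm n k' U' L') (lpm n k U L)"
    and UL': "path_pair n k' U' L'" and B: "B \<in> lpm n k U L" and p: "p \<in> {1..n} - B"
  obtains B' a b where "B' \<in> lpm n k' U' L'" "B' \<subseteq> B"
    and "a < p" "p \<le> b" "b \<le> n" "height B' a = height L' a" "height B' b = height U' b"
    and "\<forall>q\<in>B'. a < q \<and> q \<le> b \<longrightarrow> (B \<union> {p}) - {q} \<in> lpm n k U L"
proof -
  obtain B' where B': "B' \<in> lpm n k' U' L'" "B' \<subseteq> B"
    and ex: "\<And>q. q \<in> B' \<Longrightarrow> (B' \<union> {p}) - {q} \<in> lpm n k' U' L' \<Longrightarrow> (B \<union> {p}) - {q} \<in> lpm n k U L"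
    using quot B p unfolding matroid_quotient_def by blast
  have "p \<in> {1..n} - B'" using p B' by blast
  from exchange_window[OF UL' B'(1) this] obtain a b
    where "a < p" "p \<le> b" "b \<le> n" "height B' a = height L' a" "height B' b = height U' b"
      "\<forall>q\<in>B'. a < q \<and> q \<le> b \<longrightarrow> (B' \<union> {p}) - {q} \<in> lpm n k' U' L'"
    by blast
  with that B' ex show ?thesis by blast
qed

text \<open>
  An interval that spans its successor keeps doing so in every quotient; in the numerical form
  given here, use that \<open>{Suc a..b}\<close> has rank \<open>min (b - a) (height U b - height L a)\<close>. To see it
  from the bases, take the path that follows \<open>L\<close> up to \<open>a\<close>, then climbs as steeply as possible until it meets \<open>U\<close>, and
  follows \<open>U\<close> from there on. It touches \<open>L\<close> at \<open>a\<close> and \<open>U\<close> at \<open>Suc b\<close>, so the fundamental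
  circuit of \<open>Suc b\<close> lies in \<open>{Suc a..Suc b}\<close>. The contained basis of the quotient must have its
  own window inside that interval, up to elements that it does not use, and this bounds the
  rank of \<open>{Suc a..b}\<close> in the quotient.
\<close>
lemma quotient_closes_interval:
  assumes quot: "matroid_quotient {1..n} (lpm n k' U' L') (lpm n k U L)"
    and UL': "path_pair n k' U' L'" and UL: "path_pair n k U L"
    and b: "a \<le> b" "b < n" "Suc b \<notin> U" and sat: "height U b \<le> height L a + (b - a)"
  shows "Suc b \<notin> U' \<and> height U' b \<le> height L' a + (b - a)"
proof -
  note D = path_pairD[OF UL] and D' = path_pairD[OF UL']
  define f where "f m = (if m \<le> a then height L m else min (height L a + (m - a)) (height U m))" for m
  have bounds: "height L m \<le> f m \<and> f m \<le> height U m" if "m \<le> n" for m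
    using D(7)[OF that] height_slope[OF D(2), of a m] by (auto simp: f_def)
  have steps: "f m \<le> f (Suc m) \<and> f (Suc m) \<le> Suc (f m)" if "m < n" for m
  proof (cases "m = a")
    case True
    then show ?thesis
      using D(7)[of a] b height_Suc[OF D(1), of a] by (auto simp: f_def)
  next
    case False
    then show ?thesis
      using height_Suc[OF D(1), of m] height_Suc[OF D(2), of m] by (auto simp: f_def)
  qed
  obtain B where B: "B \<in> lpm n k U L" and h: "\<And>m. m \<le> n \<Longrightarrow> height B m = f m"
    using path_in_lpm[of n k U L f, OF UL bounds steps] by blast
  have finB: "finite B" using B finite_subset unfolding mem_lpm_iff[OF UL] by blast
  have fb: "f b = height U b"
    using sat b D(7)[of b] bounds[of b] by (auto simp: f_def)
  have fSb: "f (Suc b) = height U b" "height U (Suc b) = height U b"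
    using sat b height_Suc[OF D(1), of b] by (auto simp: f_def)
  have "Suc b \<notin> B" using height_Suc[OF finB, of b] h[of b] h[of "Suc b"] fb fSb b by auto
  then have p: "Suc b \<in> {1..n} - B" using b by auto
  obtain B' a' b' where B': "B' \<in> lpm n k' U' L'" "B' \<subseteq> B"
    and w: "a' < Suc b" "Suc b \<le> b'" "b' \<le> n"
    and t: "height B' a' = height L' a'" "height B' b' = height U' b'"
    and ex: "\<forall>q\<in>B'. a' < q \<and> q \<le> b' \<longrightarrow> (B \<union> {Suc b}) - {q} \<in> lpm n k U L"
    using quotient_window[OF quot UL' B p] .
  have finB': "finite B'" using B'(2) finB finite_subset by blast
  have bB': "height L' m \<le> height B' m" "height B' m \<le> height U' m" if "m \<le> n" for m
    using B'(1) that unfolding mem_lpm_iff[OF UL'] by auto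
  have loc: "a < q \<and> q \<le> b" if "q \<in> B'" "a' < q" "q \<le> b'" for q
  proof -
    have q: "q \<in> B" "(B \<union> {Suc b}) - {q} \<in> lpm n k U L" using that ex B'(2) by auto
    have "a < q"
      using exchange_above_touch[OF UL B _ q, of a] p b h[of a] by (simp add: f_def)
    moreover have "q \<le> Suc b"
      using exchange_below_touch[OF UL B _ q, of "Suc b"] p b h[of "Suc b"] fSb by simp
    moreover have "q \<noteq> Suc b" using q(1) p by blast
    ultimately show ?thesis by simp
  qed
  have "height B' b' = height B' b"
    using w loc by (intro height_constant[OF finB']) fastforce+
  then have Ub: "height U' (Suc b) \<le> height B' b" "height B' b = height U' b"
    using t height_mono[OF D'(1), of "Suc b" b'] height_mono[OF D'(1), of b b'] w bB'(2)[of b] b by auto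
  then have "Suc b \<notin> U'" using height_Suc[OF D'(1), of b] by (auto split: if_splits)
  moreover have "height U' b \<le> height L' a + (b - a)"
  proof (cases "a' \<le> a")
    case True
    then have "height B' a = height B' a'"
      using w b loc by (intro height_constant[OF finB']) fastforce+
    then have "height B' a \<le> height L' a" using t height_mono[OF D'(2) True] by simp
    then show ?thesis using height_slope[OF finB' b(1)] Ub by simp
  next
    case False
    then show ?thesis
      using height_slope[OF finB', of a' b] height_slope[OF D'(2), of a a'] t w Ub by simp
  qed
  ultimately show ?thesis by blast
qed

text \<open>
  An element outside \<open>U\<close> is spanned by its predecessors, and this persists in a quotient.
\<close>
lemma quotient_upper_subset:
  assumes "matroid_quotient {1..n} (lpm n k' U' L') (lpm n k U L)"
    and UL': "path_pair n k' U' L'" and UL: "path_pair n k U L"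
  shows "U' \<subseteq> U"
proof (rule subsetI, rule ccontr)
  fix p assume p: "p \<in> U'" "p \<notin> U"
  then obtain b where b: "p = Suc b" "b < n" using path_pairD(3)[OF UL'] by (cases p) auto
  show False
    using quotient_closes_interval[OF assms, of 0 b] b p
      height_slope[OF path_pairD(1)[OF UL], of 0 b] height_0[OF path_pairD(3)[OF UL]] by simp
qed

text \<open>
  Symmetrically, an element outside \<open>L\<close> is spanned by its successors, and the basis \<open>L\<close> itself
  exhibits this: it touches the lower boundary just before the element.
\<close>
lemma quotient_lower_subset:
  assumes quot: "matroid_quotient {1..n} (lpm n k' U' L') (lpm n k U L)"
    and UL': "path_pair n k' U' L'" and UL: "path_pair n k U L"
  shows "L' \<subseteq> L"
proof (rule subsetI, rule ccontr)
  fix p assume pL: "p \<in> L'" "p \<notin> L"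
  note D = path_pairD[OF UL] and D' = path_pairD[OF UL']
  obtain b where b: "p = Suc b" "b < n" using pL D'(4) by (cases p) auto
  have LL: "L \<in> lpm n k U L" using D by (simp add: mem_lpm_iff[OF UL])
  have p: "p \<in> {1..n} - L" using pL b by auto
  obtain B' a' b' where B': "B' \<in> lpm n k' U' L'" "B' \<subseteq> L"
    and w: "a' < p" "p \<le> b'" "b' \<le> n"
    and t: "height B' a' = height L' a'" "height B' b' = height U' b'"
    and ex: "\<forall>q\<in>B'. a' < q \<and> q \<le> b' \<longrightarrow> (L \<union> {p}) - {q} \<in> lpm n k U L"
    using quotient_window[OF quot UL' LL p] .
  have finB': "finite B'" using B'(2) D(2) finite_subset by blast
  have "p < q" if "q \<in> B'" "a' < q" "q \<le> b'" for q
  proof -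
    have "q \<in> L" using that(1) B'(2) by blast
    moreover have "(L \<union> {p}) - {q} \<in> lpm n k U L" using ex that by blast
    ultimately have "q \<in> L" "b < q"
      using exchange_above_touch[OF UL LL pL(2), of q b] b by simp_all
    then show ?thesis using pL(2) b(1) by (cases "q = p") auto
  qed
  then have "height B' p = height B' a'"
    using w by (intro height_constant[OF finB']) fastforce+
  moreover have "height L' p \<le> height B' p"
    using B'(1) p unfolding mem_lpm_iff[OF UL'] by auto
  ultimately show False
    using t(1) height_less[OF D'(2) pL(1) w(1)] by simp
qed

text \<open>
  Equal values of \<open>height (U - U') d\<close> and \<open>height (L - L') e\<close> mean that \<open>d\<close> and \<open>e\<close> have the
  same index among the deleted steps. Because subtraction on the naturals truncates, the last
  inequality says \<open>height L e \<le> height U d\<close> and \<open>d - height U d \<le> e - height L e\<close> at once: the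
  second inequality implies the first if \<open>e \<le> d\<close>, and the first implies the second if
  \<open>d \<le> e\<close>.
\<close>
definition paired_removal :: "nat set \<Rightarrow> nat set \<Rightarrow> nat set \<Rightarrow> nat set \<Rightarrow> bool" where
  "paired_removal U L U' L' \<longleftrightarrow> U' \<subseteq> U \<and> L' \<subseteq> L \<and>
     (\<forall>d\<in>U - U'. \<forall>e\<in>L - L'. height (U - U') d = height (L - L') e \<longrightarrow>
        height L e + (d - e) \<le> height U d)"

lemma quotient_imp_paired_removal:
  assumes quot: "matroid_quotient {1..n} (lpm n k' U' L') (lpm n k U L)"
    and UL': "path_pair n k' U' L'" and UL: "path_pair n k U L"
  shows "paired_removal U L U' L'"
  unfolding paired_removal_def
proof (intro conjI ballI impI)
  show sub: "U' \<subseteq> U" "L' \<subseteq> L"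
    using quotient_upper_subset[OF assms] quotient_lower_subset[OF assms] .
  note D = path_pairD[OF UL] and D' = path_pairD[OF UL']
  note hU = height_subset[OF D(1) sub(1)] and hL = height_subset[OF D(2) sub(2)]
  fix d e assume d: "d \<in> U - U'" and e: "e \<in> L - L'"
    and t: "height (U - U') d = height (L - L') e"
  have de: "1 \<le> d" "d \<le> n" "1 \<le> e" "e \<le> n" using d e D(3,4) by auto
  show "height L e + (d - e) \<le> height U d"
  proof (rule ccontr)
    assume neg: "\<not> ?thesis"
    show False
    proof (cases "e < d")
      case True
      (* The first p for which the interval from e + 1 to p exceeds its rank makes that interval
         a circuit. In the quotient the same interval gains rank, since among the steps
         before p fewer have been deleted from U than from L up to e. *)
      define P where "P m \<longleftrightarrow> e \<le> m \<and> height U m < height L e + (m - e)" for m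
      define p where "p = (LEAST m. P m)"
      have Pd: "P d" using neg True by (simp add: P_def)
      have P: "P p" and pd: "p \<le> d"
        unfolding p_def using LeastI[of P, OF Pd] Least_le[of P, OF Pd] .
      have "p \<noteq> e" using P D(7)[of e] de by (auto simp: P_def)
      then obtain b where b: "p = Suc b" "e \<le> b" using P by (cases p) (auto simp: P_def)
      have "\<not> P b" using not_less_Least[of b P] b by (simp add: p_def)
      then have hb: "Suc b \<notin> U" "height U b = height L e + (b - e)"
        using P b height_Suc[OF D(1), of b] by (auto simp: P_def split: if_splits)
      have bd: "b < d" using pd b by simp
      have "height U' b \<le> height L' e + (b - e)"
        using quotient_closes_interval[OF assms b(2) _ hb(1)] hb(2) bd de by simp
      moreover have "height (U - U') b < height (U - U') d"
        using height_less[of "U - U'" d b] D(1) d bd by simp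
      ultimately show False using hb(2) hU[of b] hL[of e] t by simp
    next
      case False
      then have lt: "height U d < height L e" using neg by simp
      then have "d \<noteq> e" using D(7)[OF de(2)] by auto
      then have de': "d \<le> e - 1" "e - 1 \<le> n" using False de by auto
      (* Follow U up to d, then stay level until L forces the path up: this is the basis with the
         fewest elements strictly between d and e. *)
      define f where "f m = (if m \<le> d then height U m else max (height U d) (height L m))" for m
      have "height L m \<le> f m \<and> f m \<le> height U m" if "m \<le> n" for m
        using D(7)[OF that] height_mono[OF D(1), of d m] by (auto simp: f_def)
      moreover have "f m \<le> f (Suc m) \<and> f (Suc m) \<le> Suc (f m)" if "m < n" for m
      proof (cases "m = d")
        case True
        then show ?thesis using D(7)[of d] de height_Suc[OF D(2), of d] by (auto simp: f_def)
      next
        case False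
        then show ?thesis
          using height_Suc[OF D(1), of m] height_Suc[OF D(2), of m] by (auto simp: f_def)
      qed
      ultimately obtain B where B: "B \<in> lpm n k U L" and h: "\<And>m. m \<le> n \<Longrightarrow> height B m = f m"
        using path_in_lpm[of n k U L f, OF UL] by blast
      obtain B' where B': "B' \<in> lpm n k' U' L'" "B' \<subseteq> B"
        using quotient_basis_subset[OF quot UL' UL B] .
      have finB: "finite B" using B finite_subset unfolding mem_lpm_iff[OF UL] by blast
      have "height L (e - 1) + 1 = height L e" "height L' (e - 1) = height L' e"
        using height_Suc[OF D(2), of "e - 1"] height_Suc[OF D'(2), of "e - 1"] e de by auto
      moreover have "height B d = height U d" "height B (e - 1) = max (height U d) (height L (e - 1))"
        using h[of d] h[of "e - 1"] de de' by (auto simp: f_def max_def intro: antisym D(7))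
      moreover have "height L' (e - 1) \<le> height B' (e - 1)" "height B' d \<le> height U' d"
        using B'(1) de de' unfolding mem_lpm_iff[OF UL'] by auto
      moreover have "height (B - B') d \<le> height (B - B') (e - 1)"
        using height_mono[of "B - B'" d "e - 1"] finB de' by simp
      ultimately show False
        using height_subset[OF finB B'(2), of d] height_subset[OF finB B'(2), of "e - 1"]
          lt hU[of d] hL[of e] t by linarith
    qed
  qed
qed

section \<open>Removing one pair of steps\<close>

lemma path_pair_remove:
  assumes UL: "path_pair n k U L" and d: "d \<in> U" and e: "e \<in> L"
    and good: "height L e + (d - e) \<le> height U d"
  shows "path_pair n (k - 1) (U - {d}) (L - {e})"
  unfolding path_pair_iff
proof (intro conjI)
  note D = path_pairD[OF UL]
  show "U - {d} \<in> k_subsets n (k - 1)" "L - {e} \<in> k_subsets n (k - 1)"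
    unfolding k_subsets_def using D(3-6) d e by (auto simp: card_Diff_singleton)
  show "\<forall>m\<le>n. height (L - {e}) m \<le> height (U - {d}) m"
  proof (intro allI impI)
    fix m assume m: "m \<le> n"
    (* The two heights could only cross while d is already gone and e is not yet. *)
    have "height L m < height U m" if "m < e" "d \<le> m"
      using height_less[OF D(2) e that(1)] height_mono[OF D(1) that(2)] good by linarith
    then show "height (L - {e}) m \<le> height (U - {d}) m"
      using height_remove[OF D(1) d, of m] height_remove[OF D(2) e, of m] D(7)[OF m]
      by (cases "m < e"; cases "d \<le> m") simp_all
  qed
qed

text \<open>
  Given \<open>B\<close> and the window from \<open>a\<close> to \<open>b\<close> of \<open>p\<close>, look for \<open>h \<in> B\<close> such that \<open>B - {h}\<close> stays
  between the new boundaries and touches them at \<open>a\<close> and \<open>b\<close>; then the window of \<open>p\<close> cannot grow.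
  Staying below the new upper boundary forces \<open>h\<close> not to come after the first touch \<open>y\<close> of \<open>U\<close>
  from \<open>d\<close> on, and staying above the new lower one forces \<open>h\<close> to come after the last touch \<open>x\<close> of
  \<open>L\<close> before \<open>e\<close>. To keep the touch at \<open>a\<close>, \<open>h\<close> must be at most \<open>a\<close> if \<open>e\<close> is, and
  to keep the touch at \<open>b\<close>, it must exceed \<open>b\<close> if \<open>d\<close> does. These demands leave an interval on
  which \<open>B\<close> still rises.
\<close>
lemma remove_pair_quotient:
  assumes UL: "path_pair n k U L" and d: "d \<in> U" and e: "e \<in> L"
    and good: "height L e + (d - e) \<le> height U d"
  shows "matroid_quotient {1..n} (lpm n (k - 1) (U - {d}) (L - {e})) (lpm n k U L)"
  unfolding matroid_quotient_def
proof (intro ballI)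
  note D = path_pairD[OF UL]
  note UL' = path_pair_remove[OF assms]
  let ?U = "U - {d}" and ?L = "L - {e}"
  note hU = height_remove[OF D(1) d] and hL = height_remove[OF D(2) e]
  fix B p assume B: "B \<in> lpm n k U L" and p: "p \<in> {1..n} - B"
  have sub: "B \<subseteq> {1..n}" and bB: "\<And>m. m \<le> n \<Longrightarrow> height L m \<le> height B m \<and> height B m \<le> height U m"
    using B unfolding mem_lpm_iff[OF UL] by auto
  have finB: "finite B" using sub finite_subset by blast
  have cB: "card B = k" using B by (simp add: lpm_def k_subsets_def)
  have dn: "d \<le> n" and en: "1 \<le> e" "e \<le> n" using d e D(3,4) by auto
  obtain a b where w: "a < p" "p \<le> b" "b \<le> n"
    and t: "height B a = height L a" "height B b = height U b"
    and ex: "\<forall>q\<in>B. a < q \<and> q \<le> b \<longrightarrow> (B \<union> {p}) - {q} \<in> lpm n k U L"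
    using exchange_window[OF UL B p] .
  define P where "P m \<longleftrightarrow> m < e \<and> height B m = height L m" for m
  define x where "x = (GREATEST m. P m)"
  have P0: "P 0" using sub D en by (simp add: P_def height_0)
  have bdP: "\<And>m. P m \<Longrightarrow> m \<le> e" by (simp add: P_def)
  have Px: "P x" unfolding x_def by (rule GreatestI_nat[of P, OF P0 bdP])
  have gx: "m \<le> x" if "P m" for m unfolding x_def by (rule Greatest_le_nat[of P, OF that bdP])
  define Q where "Q m \<longleftrightarrow> d \<le> m \<and> height B m = height U m" for m
  define y where "y = (LEAST m. Q m)"
  have Qn: "Q n" using dn cB D sub height_top[of _ n n] by (simp add: Q_def)
  have Qy: "Q y" and yn: "y \<le> n" unfolding y_def using LeastI[of Q, OF Qn] Least_le[of Q, OF Qn] .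
  have ly: "y \<le> m" if "Q m" for m unfolding y_def by (rule Least_le[of Q, OF that])
  define lo where "lo = (if b < d then max x b else x)"
  define hi where "hi = (if e \<le> a then min y a else y)"
  have "height B lo < height B hi"
  proof -
    have xy: "height B x < height B y"
      using Px Qy height_less[OF D(2) e, of x] height_mono[OF D(1), of d y] good
      by (auto simp: P_def Q_def)
    have xa: "height B x < height B a" if "e \<le> a"
      using Px height_less[OF D(2) e, of x] height_mono[OF D(2) that] t(1) by (simp add: P_def)
    have by': "height B b < height B y" if "b < d"
      using Qy height_less[OF D(1) d that] height_mono[OF D(1), of d y] t(2) by (simp add: Q_def)
    (* This is the one place where the east coordinates of d and e matter: the east step p between
       the two touching points would put d further east than e. *)
    have "\<not> (e \<le> a \<and> b < d)"
    proof
      assume "e \<le> a \<and> b < d"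
      then have ea: "e \<le> a" "b \<le> d" and "e \<le> b" using w by auto
      have "height B p = height B (p - 1)"
        using height_Suc[OF finB, of "p - 1"] p by auto
      then have "height B b + 1 \<le> height B a + (b - a)"
        using height_slope[OF finB, of a "p - 1"] height_slope[OF finB w(2)] w by (cases p) auto
      moreover have "height L a \<le> height L e + (a - e)" "height U d \<le> height U b + (d - b)"
        using height_slope[OF D(2) ea(1)] height_slope[OF D(1) ea(2)] .
      ultimately show False using good t ea w by simp
    qed
    then show ?thesis using xy xa by' by (auto simp: lo_def hi_def max_def min_def)
  qed
  from height_less_imp_elem[OF finB this] obtain h where h: "h \<in> B" "lo < h" "h \<le> hi" .
  note hB = height_remove[OF finB h(1)]
  have hx: "x < h" and hb: "b < d \<Longrightarrow> b < h" using h(2) by (auto simp: lo_def split: if_splits)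
  have hy: "h \<le> y" and ha: "e \<le> a \<Longrightarrow> h \<le> a" using h(3) by (auto simp: hi_def split: if_splits)
  let ?B = "B - {h}"
  have B': "?B \<in> lpm n (k - 1) ?U ?L"
    unfolding mem_lpm_iff[OF UL']
  proof (intro conjI allI impI)
    fix m assume m: "m \<le> n"
    have "height L m < height B m" if "h \<le> m" "m < e"
      using gx[of m] hx bB[OF m] that by (fastforce simp: P_def)
    then show "height ?L m \<le> height ?B m"
      using hL[of m] hB[of m] bB[OF m] by (cases "m < e"; cases "h \<le> m") auto
    have "height B m < height U m" if "\<not> h \<le> m" "d \<le> m"
      using ly[of m] hy bB[OF m] that by (fastforce simp: Q_def)
    then show "height ?B m \<le> height ?U m"
      using hU[of m] hB[of m] bB[OF m] by (cases "d \<le> m"; cases "h \<le> m") auto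
  qed (use sub in auto)
  have touch_a: "height ?B a \<le> height ?L a"
  proof (cases "e \<le> a")
    case True
    then show ?thesis using hL[of a] hB[of a] t(1) ha by simp
  next
    case False
    then show ?thesis using hL[of a] hB[of a] t(1) gx[of a] hx by (simp add: P_def)
  qed
  have touch_b: "height ?U b \<le> height ?B b"
  proof (cases "b < d")
    case True
    then show ?thesis using hU[of b] hB[of b] t(2) hb by simp
  next
    case False
    then show ?thesis using hU[of b] hB[of b] t(2) ly[of b] hy by (simp add: Q_def)
  qed
  show "\<exists>B'\<in>lpm n (k - 1) ?U ?L. B' \<subseteq> B \<and>
    (\<forall>q\<in>B'. (B' \<union> {p}) - {q} \<in> lpm n (k - 1) ?U ?L \<longrightarrow> (B \<union> {p}) - {q} \<in> lpm n k U L)"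
  proof (intro bexI[OF _ B'] conjI ballI impI)
    fix q assume q: "q \<in> ?B" and q': "(?B \<union> {p}) - {q} \<in> lpm n (k - 1) ?U ?L"
    have pB: "p \<notin> ?B" using p by blast
    have "a < q" using exchange_above_touch[OF UL' B' pB q q' w(1)] w touch_a by simp
    moreover have "q \<le> b" using exchange_below_touch[OF UL' B' pB q q' w(2,3) touch_b] .
    ultimately show "(B \<union> {p}) - {q} \<in> lpm n k U L" using ex q by blast
  qed auto
qed

section \<open>Factoring a quotient\<close>

lemma matroid_quotient_refl: "matroid_quotient E M M"
  unfolding matroid_quotient_def by blast

lemma matroid_quotient_trans:
  assumes M'': "matroid_quotient E M'' M'" and M': "matroid_quotient E M' M"
  shows "matroid_quotient E M'' M"
  unfolding matroid_quotient_def
proof (intro ballI)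
  fix B p assume B: "B \<in> M" and p: "p \<in> E - B"
  obtain B' where B': "B' \<in> M'" "B' \<subseteq> B"
    and ex': "\<forall>q\<in>B'. (B' \<union> {p}) - {q} \<in> M' \<longrightarrow> (B \<union> {p}) - {q} \<in> M"
    using M'[unfolded matroid_quotient_def, rule_format, OF B p] by blast
  have "p \<in> E - B'" using p B'(2) by blast
  then obtain B'' where B'': "B'' \<in> M''" "B'' \<subseteq> B'"
    and ex'': "\<forall>q\<in>B''. (B'' \<union> {p}) - {q} \<in> M'' \<longrightarrow> (B' \<union> {p}) - {q} \<in> M'"
    using M''[unfolded matroid_quotient_def, rule_format, OF B'(1)] by blast
  show "\<exists>B''\<in>M''. B'' \<subseteq> B \<and>
      (\<forall>q\<in>B''. (B'' \<union> {p}) - {q} \<in> M'' \<longrightarrow> (B \<union> {p}) - {q} \<in> M)"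
    using B''(2) B'(2) ex' ex'' by (intro bexI[OF _ B''(1)]) (simp add: subset_iff)
qed

text \<open>
  Deleting the first pair lowers the index of every later deleted step, as well as its height, by
  one on both sides, so the condition on the remaining pairs does not change.
\<close>
lemma paired_removal_first_pair:
  assumes UL: "path_pair n k U L" and UL': "path_pair n k' U' L'"
    and rem: "paired_removal U L U' L'" and "k' < k"
  obtains d e where "d \<in> U - U'" "e \<in> L - L'" "height L e + (d - e) \<le> height U d"
    and "paired_removal (U - {d}) (L - {e}) U' L'"
proof -
  note D = path_pairD[OF UL] and D' = path_pairD[OF UL']
  have sub: "U' \<subseteq> U" "L' \<subseteq> L" using rem by (auto simp: paired_removal_def)
  have fin: "finite (U - U')" "finite (L - L')" using D by auto
  have ne: "U - U' \<noteq> {}" "L - L' \<noteq> {}"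
    using D D' \<open>k' < k\<close> card_mono[of U' U] card_mono[of L' L] by auto
  define d where "d = Min (U - U')"
  define e where "e = Min (L - L')"
  have d: "d \<in> U - U'" and e: "e \<in> L - L'" using Min_in fin ne by (auto simp: d_def e_def)
  have md: "\<And>x. x \<in> U - U' \<Longrightarrow> d \<le> x" and me: "\<And>x. x \<in> L - L' \<Longrightarrow> e \<le> x"
    using fin by (auto simp: d_def e_def)
  have "(U - U') \<inter> {..d} = {d}" "(L - L') \<inter> {..e} = {e}"
    using d e md me by (auto intro: antisym)
  then have "height (U - U') d = height (L - L') e" by (simp add: height_def)
  then have good: "height L e + (d - e) \<le> height U d"
    using rem d e unfolding paired_removal_def by blast
  have "paired_removal (U - {d}) (L - {e}) U' L'"
    unfolding paired_removal_def
  proof (intro conjI ballI impI)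
    fix d' e' assume d': "d' \<in> U - {d} - U'" and e': "e' \<in> L - {e} - L'"
      and h: "height (U - {d} - U') d' = height (L - {e} - L') e'"
    have swap: "U - {d} - U' = U - U' - {d}" "L - {e} - L' = L - L' - {e}" by auto
    have le: "d \<le> d'" "e \<le> e'" using d' e' md me by auto
    have "height (U - U') d' = height (L - L') e'"
      using h le height_remove[OF fin(1) d, of d'] height_remove[OF fin(2) e, of e']
      unfolding swap by simp
    then have "height L e' + (d' - e') \<le> height U d'"
      using rem d' e' unfolding paired_removal_def by blast
    then show "height (L - {e}) e' + (d' - e') \<le> height (U - {d}) d'"
      using le d e height_remove[OF D(1), of d d'] height_remove[OF D(2), of e e'] by simp
  qed (use sub d e in auto)
  with that d e good show ?thesis by blast
qed

lemma paired_removal_same_rank: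
  assumes UL: "path_pair n k U L" and UL': "path_pair n k U' L'" and rem: "paired_removal U L U' L'"
  shows "U' = U" "L' = L"
proof -
  note D = path_pairD[OF UL] and D' = path_pairD[OF UL']
  have "U' \<subseteq> U" "L' \<subseteq> L" using rem by (auto simp: paired_removal_def)
  then show "U' = U" "L' = L"
    using card_subset_eq[OF D(1)] card_subset_eq[OF D(2)] D(5,6) D'(5,6) by simp_all
qed

lemma paired_removal_rank_le:
  assumes UL: "path_pair n k U L" and UL': "path_pair n k' U' L'" and rem: "paired_removal U L U' L'"
  shows "k' \<le> k"
proof -
  have "U' \<subseteq> U" using rem by (simp add: paired_removal_def)
  then show ?thesis
    using card_mono[OF path_pairD(1)[OF UL], of U'] path_pairD(5)[OF UL] path_pairD(5)[OF UL'] by simp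
qed

lemma paired_removal_imp_quotient:
  assumes "path_pair n k U L" "path_pair n k' U' L'" "paired_removal U L U' L'"
  shows "matroid_quotient {1..n} (lpm n k' U' L') (lpm n k U L)"
  using assms
proof (induction k arbitrary: U L rule: less_induct)
  case (less k)
  show ?case
  proof (cases "k' = k")
    case True
    then show ?thesis using paired_removal_same_rank[of n k U L U' L'] less.prems matroid_quotient_refl by simp
  next
    case False
    then have lt: "k' < k" using paired_removal_rank_le less.prems by fastforce
    obtain d e where de: "d \<in> U - U'" "e \<in> L - L'" and good: "height L e + (d - e) \<le> height U d"
      and rem: "paired_removal (U - {d}) (L - {e}) U' L'"
      using paired_removal_first_pair[OF less.prems lt] .
    have "d \<in> U" "e \<in> L" using de by auto
    note step = path_pair_remove[OF less.prems(1) this good]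
      remove_pair_quotient[OF less.prems(1) this good]
    show ?thesis
      using matroid_quotient_trans[OF less.IH[OF _ step(1) less.prems(2) rem] step(2)] lt by simp
  qed
qed

section \<open>Posets with a rank function\<close>

text \<open>
  A rank function without gaps along related elements maps every maximal chain bijectively onto
  \<open>{..N}\<close>: if a chain skipped a rank, an element strictly between its two neighbours of the
  missing rank could be added.
\<close>
lemma graded_posetI:
  fixes rank :: "'a \<Rightarrow> nat"
  assumes po: "partial_order_on P r"
    and least: "least \<in> P" "rank least = 0" "\<And>x. x \<in> P \<Longrightarrow> (least, x) \<in> r"
    and greatest: "greatest \<in> P" "rank greatest = N" "\<And>x. x \<in> P \<Longrightarrow> (x, greatest) \<in> r"
    and strict: "\<And>x y. (x, y) \<in> r \<Longrightarrow> x \<noteq> y \<Longrightarrow> rank x < rank y"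
    and dense: "\<And>x y. (x, y) \<in> r \<Longrightarrow> rank x + 1 < rank y \<Longrightarrow>
      \<exists>z. (x, z) \<in> r \<and> (z, y) \<in> r \<and> rank x < rank z \<and> rank z < rank y"
  shows "graded_poset P r"
  unfolding graded_poset_def
proof (intro conjI exI allI impI)
  note PO = partial_order_onD[OF po]
  fix C assume "pred_on.maxchain P (\<lambda>x y. (x, y) \<in> r) C"
  then have CP: "C \<subseteq> P" and comp: "\<And>x y. x \<in> C \<Longrightarrow> y \<in> C \<Longrightarrow> (x, y) \<in> r \<or> (y, x) \<in> r"
    and max: "\<And>S. S \<subseteq> P \<Longrightarrow> C \<subseteq> S \<Longrightarrow> (\<And>x y. x \<in> S \<Longrightarrow> y \<in> S \<Longrightarrow> (x, y) \<in> r \<or> (y, x) \<in> r) \<Longrightarrow> C = S"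
    using PO(1) unfolding pred_on.maxchain_def pred_on.chain_def refl_on_def by blast+
  have refl: "(x, x) \<in> r" if "x \<in> P" for x using PO(1) that by (auto simp: refl_on_def)
  have le: "rank x \<le> rank y" if "(x, y) \<in> r" for x y
    using strict[OF that] by (cases "x = y") auto
  have insert: "z \<in> C" if "z \<in> P" "\<And>x. x \<in> C \<Longrightarrow> (x, z) \<in> r \<or> (z, x) \<in> r" for z
    using max[of "insert z C"] CP comp that refl by blast
  have ends: "least \<in> C" "greatest \<in> C" using insert least greatest CP by blast+
  have inj: "inj_on rank C"
    using comp strict by (intro inj_onI) (metis less_irrefl)
  have "rank ` C = {..N}"
  proof (intro equalityI subsetI)
    fix k assume "k \<in> rank ` C"
    then show "k \<in> {..N}" using CP greatest le by fastforce
  next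
    fix k assume k: "k \<in> {..N}"
    show "k \<in> rank ` C"
    proof (rule ccontr)
      assume no: "k \<notin> rank ` C"
      define R where "R j \<longleftrightarrow> j < k \<and> j \<in> rank ` C" for j
      define i where "i = (GREATEST j. R j)"
      have "0 \<noteq> k" using no ends least(2) by (metis imageI)
      then have R0: "R 0" using ends least(2) by (force simp: R_def)
      have bd: "\<And>j. R j \<Longrightarrow> j \<le> k" by (simp add: R_def)
      have Ri: "R i" unfolding i_def by (rule GreatestI_nat[of R, OF R0 bd])
      have gi: "j \<le> i" if "R j" for j unfolding i_def by (rule Greatest_le_nat[of R, OF that bd])
      define S where "S j \<longleftrightarrow> k < j \<and> j \<in> rank ` C" for j
      define l where "l = (LEAST j. S j)"
      have "N \<noteq> k" using no ends greatest(2) by (metis imageI)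
      then have SN: "S N" using ends greatest(2) k by (force simp: S_def)
      have Sl: "S l" unfolding l_def by (rule LeastI[of S, OF SN])
      have ll: "l \<le> j" if "S j" for j unfolding l_def by (rule Least_le[of S, OF that])
      obtain x y where x: "x \<in> C" "rank x = i" and y: "y \<in> C" "rank y = l"
        using Ri Sl by (auto simp: R_def S_def)
      have lt: "i < k" "k < l" using Ri Sl by (auto simp: R_def S_def)
      then have "(x, y) \<in> r" using comp[OF x(1) y(1)] le[of y x] x y by auto
      then obtain z where z: "(x, z) \<in> r" "(z, y) \<in> r" "i < rank z" "rank z < l"
        using dense[of x y] lt x y by auto
      have "(w, z) \<in> r \<or> (z, w) \<in> r" if w: "w \<in> C" for w
      proof -
        have "rank w \<noteq> k" using no w by blast
        then consider "rank w \<le> i" | "l \<le> rank w"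
          using gi[of "rank w"] ll[of "rank w"] w unfolding R_def S_def by fastforce
        then show ?thesis
        proof cases
          case 1
          then have "(w, x) \<in> r" using comp[OF w x(1)] strict[of x w] x by fastforce
          then show ?thesis using z(1) PO(2) by (meson transD)
        next
          case 2
          then have "(y, w) \<in> r" using comp[OF w y(1)] strict[of w y] y by fastforce
          then show ?thesis using z(2) PO(2) by (meson transD)
        qed
      qed
      then have "z \<in> C" using insert z(1) PO(4) by blast
      then show False
        using gi[of "rank z"] ll[of "rank z"] no z unfolding R_def S_def by fastforce
    qed
  qed
  then show "finite C" "card C = N + 1"
    using inj finite_imageD[of rank C] card_image[OF inj] by auto
qed (rule po)

section \<open>The poset of lattice path matroids\<close>

text \<open>
  All bases of a matroid have the same cardinality, so any of them may be used.
\<close>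
definition rank_of_bases :: "nat set set \<Rightarrow> nat" where
  "rank_of_bases M = card (SOME B. B \<in> M)"

lemma rank_lpm:
  assumes "path_pair n k U L"
  shows "rank_of_bases (lpm n k U L) = k"
proof -
  have "U \<in> lpm n k U L" using path_pairD[OF assms] by (simp add: mem_lpm_iff[OF assms])
  then have "(SOME B. B \<in> lpm n k U L) \<in> lpm n k U L" by (rule someI)
  then show ?thesis by (simp add: rank_of_bases_def lpm_def k_subsets_def)
qed

lemma lpm_quotient_orderE:
  assumes "(M', M) \<in> lpm_quotient_order n"
  obtains k' U' L' k U L where "path_pair n k' U' L'" "M' = lpm n k' U' L'"
    and "path_pair n k U L" "M = lpm n k U L" and "paired_removal U L U' L'"
  using assms quotient_imp_paired_removal unfolding lpm_quotient_order_def
  by (auto elim!: lattice_path_matroidsE)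

lemma lpm_quotient_orderI:
  assumes "path_pair n k' U' L'" "path_pair n k U L" "paired_removal U L U' L'"
  shows "(lpm n k' U' L', lpm n k U L) \<in> lpm_quotient_order n"
  using assms lpm_in_lattice_path_matroids paired_removal_imp_quotient
  unfolding lpm_quotient_order_def by blast

lemma rank_strict_mono:
  assumes "(M', M) \<in> lpm_quotient_order n" "M' \<noteq> M"
  shows "rank_of_bases M' < rank_of_bases M"
  using assms(1)
proof (cases rule: lpm_quotient_orderE)
  case (1 k' U' L' k U L)
  have "k' \<noteq> k" using paired_removal_same_rank[of n k U L U' L'] 1 assms(2) by blast
  then show ?thesis
    using paired_removal_rank_le[OF 1(3,1,5)] 1 by (simp add: rank_lpm)
qed

lemma quotient_interpolation:
  assumes "(M', M) \<in> lpm_quotient_order n" "rank_of_bases M' + 1 < rank_of_bases M"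
  shows "\<exists>N. (M', N) \<in> lpm_quotient_order n \<and> (N, M) \<in> lpm_quotient_order n \<and>
    rank_of_bases M' < rank_of_bases N \<and> rank_of_bases N < rank_of_bases M"
  using assms(1)
proof (cases rule: lpm_quotient_orderE)
  case (1 k' U' L' k U L)
  then have k: "k' + 1 < k" using assms(2) by (simp add: rank_lpm)
  then obtain d e where de: "d \<in> U - U'" "e \<in> L - L'" and good: "height L e + (d - e) \<le> height U d"
    and rem: "paired_removal (U - {d}) (L - {e}) U' L'"
    using paired_removal_first_pair[OF 1(3,1,5)] by (metis add_lessD1)
  let ?N = "lpm n (k - 1) (U - {d}) (L - {e})"
  have "d \<in> U" "e \<in> L" using de by auto
  note UL = path_pair_remove[OF 1(3) this good]
    and quot = remove_pair_quotient[OF 1(3) this good]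
  have "(M', ?N) \<in> lpm_quotient_order n"
    using lpm_quotient_orderI[OF 1(1) UL rem] 1(2) by simp
  moreover have "(?N, M) \<in> lpm_quotient_order n"
    using quot lpm_in_lattice_path_matroids UL 1 unfolding lpm_quotient_order_def by blast
  moreover have "rank_of_bases M' = k'" "rank_of_bases ?N = k - 1" "rank_of_bases M = k"
    using 1 UL by (simp_all add: rank_lpm)
  ultimately show ?thesis using k by (intro exI[of _ ?N]) auto
qed

lemma partial_order_lpm_quotient_order:
  "partial_order_on (lattice_path_matroids n) (lpm_quotient_order n)"
  unfolding partial_order_on_def preorder_on_def
proof (intro conjI)
  show "lpm_quotient_order n \<subseteq> lattice_path_matroids n \<times> lattice_path_matroids n"
    "refl_on (lattice_path_matroids n) (lpm_quotient_order n)"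
    using matroid_quotient_refl by (auto simp: lpm_quotient_order_def refl_on_def)
  show "trans (lpm_quotient_order n)"
    using matroid_quotient_trans by (intro transI) (auto simp: lpm_quotient_order_def)
  show "antisym (lpm_quotient_order n)"
    using rank_strict_mono by (metis antisymI less_asym)
qed

lemma uniform_as_lpm:
  "path_pair n 0 {} {}" "uniform_matroid 0 n = lpm n 0 {} {}"
  "path_pair n n {1..n} {1..n}" "uniform_matroid n n = lpm n n {1..n} {1..n}"
  "uniform_matroid 0 n = {{}}" "uniform_matroid n n = {{1..n}}"
proof -
  have k0: "k_subsets n 0 = {{}}" using finite_subset[of _ "{1..n}"] by (auto simp: k_subsets_def)
  have kn: "k_subsets n n = {{1..n}}"
  proof -
    have "A \<subseteq> {1..n} \<and> card A = n \<longleftrightarrow> A = {1..n}" for A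
      using card_subset_eq[of "{1..n}" A] by (metis card_atLeastAtMost diff_Suc_1 finite_atLeastAtMost order_refl)
    then show ?thesis by (simp add: k_subsets_def)
  qed
  show "path_pair n 0 {} {}" "path_pair n n {1..n} {1..n}"
    by (auto simp: path_pair_def k0 kn gale_le_def)
  show "uniform_matroid 0 n = lpm n 0 {} {}" "uniform_matroid n n = lpm n n {1..n} {1..n}"
    by (auto simp: uniform_matroid_def lpm_def k0 kn gale_le_def)
  show "uniform_matroid 0 n = {{}}" "uniform_matroid n n = {{1..n}}"
    by (auto simp: uniform_matroid_def k0 kn)
qed

theorem proposition21:
  fixes n :: nat
  shows "graded_poset (lattice_path_matroids n) (lpm_quotient_order n) \<and>
    (uniform_matroid 0 n \<in> lattice_path_matroids n \<and>
     (\<forall>M\<in>lattice_path_matroids n. (uniform_matroid 0 n, M) \<in> lpm_quotient_order n)) \<and>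
    (uniform_matroid n n \<in> lattice_path_matroids n \<and>
     (\<forall>M\<in>lattice_path_matroids n. (M, uniform_matroid n n) \<in> lpm_quotient_order n))"
proof -
  let ?bot = "uniform_matroid 0 n" and ?top = "uniform_matroid n n"
  have mem: "?bot \<in> lattice_path_matroids n" "?top \<in> lattice_path_matroids n"
    using lpm_in_lattice_path_matroids uniform_as_lpm(1-4) by metis+
  have bot: "(?bot, M) \<in> lpm_quotient_order n" if "M \<in> lattice_path_matroids n" for M
    using that mem by (auto simp: lpm_quotient_order_def matroid_quotient_def uniform_as_lpm(5))
  have top: "(M, ?top) \<in> lpm_quotient_order n" if "M \<in> lattice_path_matroids n" for M
    using that mem by (auto simp: lpm_quotient_order_def matroid_quotient_def uniform_as_lpm(6))
  have "graded_poset (lattice_path_matroids n) (lpm_quotient_order n)"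
  proof (rule graded_posetI[where rank = rank_of_bases])
    show "rank_of_bases ?bot = 0" "rank_of_bases ?top = n"
      by (simp_all add: rank_of_bases_def uniform_as_lpm(5,6))
  qed (use mem bot top partial_order_lpm_quotient_order rank_strict_mono quotient_interpolation in blast)+
  then show ?thesis using mem bot top by blast
qed

end
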